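(* The discrete fractional Sturm--Liouville problem $${_{k}}\Delta^{\alpha}_{N}\left(p(x_k)\,{_{0}}\Delta^{\alpha}_{k}y(x_k)\right)+q(x_k)y(x_k)=\lambda r(x_k)y(x_k), \quad k=1,\ldots,N-1,$$ $$y(x_0)=0,\quad y(x_N)=0,$$ has $N-1$ real eigenvalues (counted with multiplicity), denoted by $$\lambda_1\leq \lambda_2\leq\cdots \leq \lambda_{N-1}.$$ Corresponding eigenfunctions $y^1,y^2,\ldots,y^{N-1}:\{x_1,\ldots,x_{N-1}\}\rightarrow \mathbb{R}$ (with $y^i$ an eigenfunction for $\lambda_i$) can be chosen mutually orthogonal: if $i\neq j$, then $$\langle y^i,y^j\rangle_{r}:=\sum_{k=1}^{N-1}r(x_k)y^i(x_{k})y^j(x_{k})=0,$$ and they span $\mathbb{R}^{N-1}$: any vector $\varphi=\left(\varphi(x_{k})\right)_{k=1}^{N-1}\in \mathbb{R}^{N-1}$ has a unique expansion $$\varphi(x_{k})=\sum_{i=1}^{N-1}c_iy^i(x_{k}),\quad 1\leq k\leq N-1,$$ and the coefficients $c_i$ are given by $$c_i=\frac{\langle \varphi,y^i\rangle_{r}}{\langle y^i,y^i\rangle_{r}}.$$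
   Context: Let $a\in\mathbb{R}$, $h>0$, let $N\ge 2$ be an integer, and let $0<\alpha\le 1$. Put $x_j=a+jh$ for $j=0,1,\ldots,N$ and $D=\{x_0,\ldots,x_N\}$. Define $$a_0^{(\alpha)}:=1,\qquad a_i^{(\alpha)}:=(-1)^i\frac{\alpha(\alpha-1)\cdots(\alpha-i+1)}{i!}\quad (i=1,2,\ldots).$$ For $f:D\to\mathbb{R}$ and $k=0,\ldots,N$, the backward and forward (Grünwald--Letnikov) fractional differences of order $\alpha$ are $${_{0}}\Delta^{\alpha}_{k}f(x_k):=\frac{1}{h^{\alpha}}\sum_{i=0}^{k}a_i^{(\alpha)}f(x_{k-i}),\qquad {_{k}}\Delta^{\alpha}_{N}f(x_k):=\frac{1}{h^{\alpha}}\sum_{i=0}^{N-k}a_i^{(\alpha)}f(x_{k+i}).$$ In ${_{k}}\Delta^{\alpha}_{N}\left(p(x_k)\,{_{0}}\Delta^{\alpha}_{k}y(x_k)\right)$ the forward difference is applied to the function $x_j\mapsto p(x_j)\,{_{0}}\Delta^{\alpha}_{j}y(x_j)$ on $D$, evaluated at $x_k$. The functions $p,q,r:D\to\mathbb{R}$ satisfy $p(x_i)>0$ and $r(x_i)>0$ for all $i=0,\ldots,N$ ($q$ is an arbitrary real-valued function). The number $\lambda$ is a parameter. An eigenfunction is a nontrivial solution $y$ of the boundary value problem, and the corresponding value of $\lambda$ is an eigenvalue. Functions on $\{x_1,\ldots,x_{N-1}\}$ are identified with functions on $D$ vanishing at $x_0$ and $x_N$, and with vectors in $\mathbb{R}^{N-1}$.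 *)

theory Defs
  imports "HOL-Analysis.Analysis" "HOL-Library.Function_Algebras"
begin

definition grid :: "real \<Rightarrow> real \<Rightarrow> nat \<Rightarrow> real" where
  "grid a h j = a + real j * h"

definition grid_dom :: "real \<Rightarrow> real \<Rightarrow> nat \<Rightarrow> real set" where
  "grid_dom a h N = grid a h ` {0..N}"

text \<open>\<open>\<alpha> gchoose i\<close> is \<open>\<alpha> (\<alpha> - 1) \<cdots> (\<alpha> - i + 1) / i!\<close>, with value 1 at \<open>i = 0\<close>.\<close>

definition gl_coeff :: "real \<Rightarrow> nat \<Rightarrow> real" where
  "gl_coeff \<alpha> i = (- 1) ^ i * (\<alpha> gchoose i)"

text \<open>
  The differences take the sampled function \<open>u j = f (x\<^sub>j)\<close>; only the values
  \<open>u 0, \<dots>, u N\<close> are used. The codomain is a real vector space, so that both real and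
  complex functions are covered; for real functions \<open>*\<^sub>R\<close> is ordinary multiplication.
\<close>

definition backward_diff :: "real \<Rightarrow> real \<Rightarrow> (nat \<Rightarrow> 'a::real_vector) \<Rightarrow> nat \<Rightarrow> 'a" where
  "backward_diff h \<alpha> u k = (1 / h powr \<alpha>) *\<^sub>R (\<Sum>i=0..k. gl_coeff \<alpha> i *\<^sub>R u (k - i))"

definition forward_diff :: "real \<Rightarrow> nat \<Rightarrow> real \<Rightarrow> (nat \<Rightarrow> 'a::real_vector) \<Rightarrow> nat \<Rightarrow> 'a" where
  "forward_diff h N \<alpha> u k = (1 / h powr \<alpha>) *\<^sub>R (\<Sum>i=0..N - k. gl_coeff \<alpha> i *\<^sub>R u (k + i))"

text \<open>
  A function on the grid is represented by its extension by 0 to the real line. The set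
  below consists of all solutions of the boundary value problem for the parameter value \<open>\<mu>\<close>,
  the trivial one included. It is used with \<open>'a = real\<close> and \<open>'a = complex\<close>.
\<close>

definition sl_solutions ::
    "real \<Rightarrow> real \<Rightarrow> nat \<Rightarrow> real \<Rightarrow> (real \<Rightarrow> real) \<Rightarrow> (real \<Rightarrow> real) \<Rightarrow> (real \<Rightarrow> real) \<Rightarrow>
      'a::real_field \<Rightarrow> (real \<Rightarrow> 'a) set" where
  "sl_solutions a h N \<alpha> p q r \<mu> =
    {y. (\<forall>x. x \<notin> grid_dom a h N \<longrightarrow> y x = 0) \<and>
        (\<forall>k\<in>{1..N-1}.
           forward_diff h N \<alpha>
             (\<lambda>j. p (grid a h j) *\<^sub>R backward_diff h \<alpha> (\<lambda>m. y (grid a h m)) j) k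
           + q (grid a h k) *\<^sub>R y (grid a h k)
           = \<mu> * r (grid a h k) *\<^sub>R y (grid a h k)) \<and>
        y (grid a h 0) = 0 \<and> y (grid a h N) = 0}"

definition is_eigenfunction ::
    "real \<Rightarrow> real \<Rightarrow> nat \<Rightarrow> real \<Rightarrow> (real \<Rightarrow> real) \<Rightarrow> (real \<Rightarrow> real) \<Rightarrow> (real \<Rightarrow> real) \<Rightarrow>
      'a::real_field \<Rightarrow> (real \<Rightarrow> 'a) \<Rightarrow> bool" where
  "is_eigenfunction a h N \<alpha> p q r \<mu> y \<longleftrightarrow>
     y \<in> sl_solutions a h N \<alpha> p q r \<mu> \<and> (\<exists>x\<in>grid_dom a h N. y x \<noteq> 0)"

definition is_eigenvalue ::
    "real \<Rightarrow> real \<Rightarrow> nat \<Rightarrow> real \<Rightarrow> (real \<Rightarrow> real) \<Rightarrow> (real \<Rightarrow> real) \<Rightarrow> (real \<Rightarrow> real) \<Rightarrow>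
      'a::real_field \<Rightarrow> bool" where
  "is_eigenvalue a h N \<alpha> p q r \<mu> \<longleftrightarrow> (\<exists>y. is_eigenfunction a h N \<alpha> p q r \<mu> y)"

text \<open>
  The dimension of the solution space under pointwise scaling; it is 0 when \<open>\<mu>\<close> is not an
  eigenvalue.
\<close>

definition eigen_multiplicity ::
    "real \<Rightarrow> real \<Rightarrow> nat \<Rightarrow> real \<Rightarrow> (real \<Rightarrow> real) \<Rightarrow> (real \<Rightarrow> real) \<Rightarrow> (real \<Rightarrow> real) \<Rightarrow>
      'a::real_field \<Rightarrow> nat" where
  "eigen_multiplicity a h N \<alpha> p q r \<mu> =
     vector_space.dim (\<lambda>c f x. c * f x) (sl_solutions a h N \<alpha> p q r \<mu>)"

definition inner_r ::
    "real \<Rightarrow> real \<Rightarrow> nat \<Rightarrow> (real \<Rightarrow> real) \<Rightarrow> (real \<Rightarrow> real) \<Rightarrow> (real \<Rightarrow> real) \<Rightarrow> real" where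
  "inner_r a h N r f g = (\<Sum>k=1..N-1. r (grid a h k) * f (grid a h k) * g (grid a h k))"

end

theory Submission
  imports Defs
begin

text \<open>
  The forward difference is the transpose of the backward difference: both are given by the
  lower triangular matrix \<open>G\<close> with entries \<open>gl_coeff \<alpha> (j - m) / h powr \<alpha>\<close>, read by rows in one
  case and by columns in the other (\<open>backward_diff_eq_gl_matrix\<close> and
  \<open>forward_diff_eq_gl_matrix_transpose\<close>). With the boundary values \<open>0\<close>, the Sturm--Liouville operator on the interior points is therefore the matrix
  \<open>G\<^sup>T P G + diag q\<close>, with \<open>P\<close> the diagonal matrix of the values of \<open>p\<close>. It is symmetric, and the
  boundary value problem becomes the generalized eigenvalue problem \<open>A f = \<lambda> R f\<close> with \<open>A\<close>
  symmetric and \<open>R\<close> a positive diagonal matrix (\<open>sl_solutions_iff\<close>).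

  Such a problem is solved by a spectral theorem for a symmetric form \<open>Q\<close> and a weighted inner
  product \<open>ip\<close> on the functions on a finite set. Eigenvectors are found one at a time: on the unit
  sphere of the orthogonal complement of those found so far, which is compact, \<open>Q\<close> attains its
  minimum (\<open>rayleigh_minimizer\<close>), and the minimizer is a new eigenvector with the minimum as its
  eigenvalue (\<open>minimizer_eigenpair\<close>). As the complements shrink, the eigenvalues come out in
  increasing order.

  That exactly as many steps are possible as there are points follows from an identity. If
  \<open>e\<^sub>1, \<dots>, e\<^sub>n\<close> are orthonormal and \<open>\<delta>\<^sub>k\<close> is the unit vector at \<open>k\<close>, then Bessel's identity shows that the squared distances of the
  vectors \<open>\<delta>\<^sub>k\<close> from the span of the \<open>e\<^sub>i\<close>, divided by the weights, add up to the number of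
  points minus \<open>n\<close> (\<open>residual_identity\<close>). While \<open>n\<close> is smaller than the number of
  points, some residual is a nonzero vector orthogonal to all \<open>e\<^sub>i\<close>, so that the process can
  continue; when \<open>n\<close> reaches that number, all residuals vanish and every function is the sum of
  its Fourier series (\<open>orthonormal_expansion\<close>).

  The multiplicity of \<open>\<mu>\<close> is then the number of \<open>i\<close> with \<open>\<lambda>\<^sub>i = \<mu>\<close>: in the expansion of a solution
  for \<open>\<mu>\<close>, only the eigenvectors for \<open>\<mu>\<close> occur, since eigenvectors for distinct values are
  orthogonal. A complex eigenvalue is real because it is the quotient of the values of two
  Hermitian forms at an eigenvector (\<open>complex_eigenvalue_real\<close>).
\<close>

section \<open>The spectral theorem for a symmetric matrix and a positive weight\<close>

text \<open>
  This turns minimality into a first-order condition: for small \<open>t\<close> the linear term dominates and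
  would change sign with \<open>t\<close>.
\<close>

lemma linear_coeff_zero_if_quadratic_nonneg:
  fixes b d :: real
  assumes "\<And>t. 0 \<le> 2 * t * b + t\<^sup>2 * d"
  shows "b = 0"
proof -
  \<comment> \<open>At \<open>t = - b / s\<close> the quadratic is \<open>b\<^sup>2\<close> times the negative number \<open>(d - 2 s) / s\<^sup>2\<close>.\<close>
  define s where "s = 1 + \<bar>d\<bar>"
  have s: "s > 0" "d - 2 * s < 0" by (auto simp: s_def abs_if)
  have "2 * (- b / s) * b + (- b / s)\<^sup>2 * d = b\<^sup>2 * ((d - 2 * s) / s\<^sup>2)"
    using s(1) by (simp add: power2_eq_square field_simps)
  with assms[of "- b / s"] have "0 \<le> b\<^sup>2 * ((d - 2 * s) / s\<^sup>2)" by metis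
  moreover have "(d - 2 * s) / s\<^sup>2 < 0" using s by (intro divide_neg_pos) simp_all
  ultimately have "\<not> b\<^sup>2 > 0" using mult_pos_neg[of "b\<^sup>2"] by (meson not_le)
  then show ?thesis by simp
qed

text \<open>
  The index set is a set rather than a type because its size has to depend on the number \<open>N\<close> of
  grid steps. Vectors are arbitrary functions, of which only the values on \<open>I\<close> matter.
\<close>

locale weighted_symmetric_form =
  fixes I :: "'i set" and r :: "'i \<Rightarrow> real" and A :: "'i \<Rightarrow> 'i \<Rightarrow> real"
  assumes finite_I: "finite I"
    and weight_pos: "k \<in> I \<Longrightarrow> r k > 0"
    and A_sym: "k \<in> I \<Longrightarrow> m \<in> I \<Longrightarrow> A k m = A m k"
begin

definition ip :: "('i \<Rightarrow> real) \<Rightarrow> ('i \<Rightarrow> real) \<Rightarrow> real" where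
  "ip f g = (\<Sum>k\<in>I. r k * f k * g k)"

definition Q :: "('i \<Rightarrow> real) \<Rightarrow> ('i \<Rightarrow> real) \<Rightarrow> real" where
  "Q f g = (\<Sum>k\<in>I. (\<Sum>m\<in>I. A k m * f m) * g k)"

text \<open>
  The generalized eigenvalue equation \<open>A f = l R f\<close>, where \<open>R\<close> is the diagonal matrix of the
  weights. The zero function is not excluded.
\<close>

definition eigenpair :: "real \<Rightarrow> ('i \<Rightarrow> real) \<Rightarrow> bool" where
  "eigenpair l f \<longleftrightarrow> (\<forall>k\<in>I. (\<Sum>m\<in>I. A k m * f m) = l * (r k * f k))"

lemma ip_commute: "ip f g = ip g f"
  by (simp add: ip_def mult.assoc mult.commute mult.left_commute)

lemma ip_add: "ip (\<lambda>k. f k + t * g k) w = ip f w + t * ip g w"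
  by (simp add: ip_def sum.distrib sum_distrib_left algebra_simps)

lemma ip_sum: "ip (\<lambda>k. \<Sum>i\<in>J. c i * e i k) f = (\<Sum>i\<in>J. c i * ip (e i) f)"
proof -
  have "ip (\<lambda>k. \<Sum>i\<in>J. c i * e i k) f = (\<Sum>k\<in>I. \<Sum>i\<in>J. c i * (r k * e i k * f k))"
    by (simp add: ip_def sum_distrib_left sum_distrib_right algebra_simps)
  also have "\<dots> = (\<Sum>i\<in>J. c i * ip (e i) f)"
    by (subst sum.swap) (simp add: ip_def sum_distrib_left)
  finally show ?thesis .
qed

lemma ip_nonneg: "ip f f \<ge> 0"
proof -
  have "r k * f k * f k \<ge> 0" if "k \<in> I" for k
    using weight_pos[OF that] by (simp add: mult.assoc)
  then show ?thesis unfolding ip_def by (rule sum_nonneg)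
qed

lemma ip_eq_0_iff: "ip f f = 0 \<longleftrightarrow> (\<forall>k\<in>I. f k = 0)"
proof -
  have "r k * f k * f k \<ge> 0" if "k \<in> I" for k
    using weight_pos[OF that] by (simp add: mult.assoc)
  then have "ip f f = 0 \<longleftrightarrow> (\<forall>k\<in>I. r k * f k * f k = 0)"
    unfolding ip_def using finite_I by (intro sum_nonneg_eq_0_iff) auto
  then show ?thesis using weight_pos by force
qed

lemma ip_cong: "(\<And>k. k \<in> I \<Longrightarrow> f k = f' k) \<Longrightarrow> (\<And>k. k \<in> I \<Longrightarrow> g k = g' k) \<Longrightarrow> ip f g = ip f' g'"
  by (simp add: ip_def)

lemma Q_commute: "Q f g = Q g f"
proof -
  have "Q f g = (\<Sum>k\<in>I. \<Sum>m\<in>I. A k m * f m * g k)"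
    by (simp add: Q_def sum_distrib_right)
  also have "\<dots> = (\<Sum>m\<in>I. \<Sum>k\<in>I. A k m * f m * g k)"
    by (rule sum.swap)
  also have "\<dots> = (\<Sum>m\<in>I. \<Sum>k\<in>I. A m k * g k * f m)"
    by (intro sum.cong refl) (simp add: A_sym)
  also have "\<dots> = Q g f" by (simp add: Q_def sum_distrib_right)
  finally show ?thesis .
qed

lemma Q_add: "Q (\<lambda>k. f k + t * g k) w = Q f w + t * Q g w"
  by (simp add: Q_def sum.distrib sum_distrib_left sum_distrib_right algebra_simps)

lemma eigenpair_Q: "eigenpair l f \<Longrightarrow> Q f g = l * ip f g"
  by (simp add: eigenpair_def Q_def ip_def sum_distrib_left algebra_simps)

lemma eigenpair_orthogonal:
  assumes "eigenpair l f" "eigenpair l' g" "l \<noteq> l'"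
  shows "ip f g = 0"
proof -
  have "l * ip f g = l' * ip f g"
    using eigenpair_Q[OF assms(1), of g] eigenpair_Q[OF assms(2), of f]
    by (simp add: Q_commute ip_commute)
  with assms(3) show ?thesis by simp
qed

text \<open>
  The Rayleigh quotient \<open>Q g g / ip g g\<close> attains its minimum on the orthogonal complement of a
  family of vectors if the complement is not zero, since by homogeneity it suffices to minimize \<open>Q\<close> on the unit sphere of the
  complement. With values set to \<open>0\<close> outside \<open>I\<close>, this sphere is a closed subset of a product of
  compact intervals, hence compact by Tychonoff's theorem.
\<close>

lemma rayleigh_minimizer:
  assumes "\<And>j. j \<in> J \<Longrightarrow> ip f (e j) = 0" and "ip f f \<noteq> 0"
  obtains x where "ip x x = 1" "\<And>j. j \<in> J \<Longrightarrow> ip x (e j) = 0"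
    "\<And>g. (\<And>j. j \<in> J \<Longrightarrow> ip g (e j) = 0) \<Longrightarrow> Q x x * ip g g \<le> Q g g"
proof -
  \<comment> \<open>A unit vector satisfies \<open>r k * (g k)\<^sup>2 \<le> 1\<close>, which gives the bounds in \<open>B\<close>.\<close>
  define B where "B k = (if k \<in> I then {- (1 / sqrt (r k)) .. 1 / sqrt (r k)} else {0})" for k
  define K where "K = PiE UNIV B \<inter> ({g. ip g g = 1} \<inter> (\<Inter>j\<in>J. {g. ip g (e j) = 0}))"
  define unit where "unit g = (\<lambda>k. if k \<in> I then g k / sqrt (ip g g) else 0)" for g
  have norm: "ip (unit g) w = ip g w / sqrt (ip g g)"
      "ip g g * Q (unit g) (unit g) = Q g g" "ip (unit g) (unit g) = 1" if "ip g g \<noteq> 0" for g w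
  proof -
    have pos: "ip g g > 0" using that ip_nonneg[of g] by simp
    have sq: "sqrt (ip g g) * sqrt (ip g g) = ip g g" using pos by simp
    show "ip (unit g) w = ip g w / sqrt (ip g g)"
      by (simp add: ip_def[of _ w] unit_def sum_divide_distrib)
    have "ip (unit g) (unit g) = ip g g / (sqrt (ip g g) * sqrt (ip g g))"
      by (simp only: ip_def[of "unit g"] ip_def[of g g] sum_divide_distrib)
         (auto simp: unit_def ip_def intro!: sum.cong)
    then show "ip (unit g) (unit g) = 1" using sq pos by simp
    have "Q (unit g) (unit g) = Q g g / (sqrt (ip g g) * sqrt (ip g g))"
      unfolding Q_def sum_divide_distrib sum_distrib_right
      by (intro sum.cong refl) (simp add: unit_def)
    then show "ip g g * Q (unit g) (unit g) = Q g g" using sq pos by simp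
  qed
  have unit_K: "unit g \<in> K" if g: "\<And>j. j \<in> J \<Longrightarrow> ip g (e j) = 0" "ip g g \<noteq> 0" for g
  proof -
    have 1: "ip (unit g) (unit g) = 1" using norm(3) g by blast
    have "unit g k \<in> B k" for k
    proof (cases "k \<in> I")
      case True
      have "r k * unit g k * unit g k \<le> ip (unit g) (unit g)"
        unfolding ip_def
        by (rule member_le_sum) (use True finite_I weight_pos in \<open>auto simp: mult.assoc less_imp_le\<close>)
      then have "(unit g k)\<^sup>2 \<le> 1 / r k"
        using 1 weight_pos[OF True] by (simp add: field_simps power2_eq_square)
      then have "\<bar>unit g k\<bar> \<le> sqrt (1 / r k)" by (intro real_le_rsqrt) simp
      then show ?thesis using True by (simp add: B_def real_sqrt_divide abs_le_iff minus_le_iff)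
    qed (simp add: B_def unit_def)
    moreover have "ip (unit g) (e j) = 0" if "j \<in> J" for j
      using norm(1)[OF g(2), of "e j"] g that by simp
    ultimately show ?thesis using 1 by (auto simp: K_def)
  qed
  have cont: "continuous_on UNIV (\<lambda>g::'i \<Rightarrow> real. g k)" for k
    by (rule continuous_on_product_coordinates)
  have "compactin (product_topology (\<lambda>k::'i. euclideanreal) UNIV) (PiE UNIV B)"
    unfolding compactin_PiE by (auto simp: B_def compactin_euclidean_iff)
  then have "compact (PiE UNIV B)"
    by (simp add: euclidean_product_topology compactin_euclidean_iff)
  moreover have "closed {g. ip g g = 1}"
    unfolding ip_def by (intro closed_Collect_eq continuous_intros cont)
  moreover have "closed (\<Inter>j\<in>J. {g. ip g (e j) = 0})"
    unfolding ip_def by (intro closed_INT ballI closed_Collect_eq continuous_intros cont)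
  ultimately have "compact K" unfolding K_def by (intro compact_Int_closed closed_Int)
  moreover have "K \<noteq> {}" using unit_K[of f] assms by blast
  moreover have "continuous_on K (\<lambda>g. Q g g)"
    unfolding Q_def by (intro continuous_intros continuous_on_subset[OF cont]) auto
  ultimately obtain x where x: "x \<in> K" "\<And>g. g \<in> K \<Longrightarrow> Q x x \<le> Q g g"
    using continuous_attains_inf[of K "\<lambda>g. Q g g"] by blast
  have "Q x x * ip g g \<le> Q g g" if g: "\<And>j. j \<in> J \<Longrightarrow> ip g (e j) = 0" for g
  proof (cases "ip g g = 0")
    case True
    then have "Q g g = 0" by (simp add: ip_eq_0_iff Q_def)
    with True show ?thesis by simp
  next
    case False
    have "Q x x \<le> Q (unit g) (unit g)" using x(2) unit_K g False by blast
    then have "Q x x * ip g g \<le> Q (unit g) (unit g) * ip g g"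
      by (rule mult_right_mono) (rule ip_nonneg)
    with norm(2)[OF False] show ?thesis by (simp add: mult.commute)
  qed
  with x(1) that show ?thesis by (auto simp: K_def)
qed

text \<open>
  Let \<open>\<kappa>\<close> be the minimum and \<open>W\<close> the orthogonal complement of the known eigenvectors. The form
  \<open>Q - \<kappa> ip\<close> is nonnegative on \<open>W\<close> and vanishes at the minimizer \<open>x\<close>, hence \<open>x\<close> is orthogonal to
  \<open>W\<close> with respect to this form. The vector \<open>w = R\<^sup>-\<^sup>1 A x - \<kappa> x\<close> represents the functional
  \<open>Q x - \<kappa> ip x\<close>. It lies in \<open>W\<close>, since the known vectors are eigenvectors orthogonal to \<open>x\<close>;
  therefore it is orthogonal to itself and vanishes, which is the eigenvalue equation for \<open>x\<close>.
\<close>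

lemma minimizer_eigenpair:
  assumes e: "\<And>j. j \<in> J \<Longrightarrow> eigenpair (l j) (e j)"
    and x: "ip x x = 1" "\<And>j. j \<in> J \<Longrightarrow> ip x (e j) = 0"
    and min: "\<And>g. (\<And>j. j \<in> J \<Longrightarrow> ip g (e j) = 0) \<Longrightarrow> Q x x * ip g g \<le> Q g g"
  shows "eigenpair (Q x x) x"
proof -
  define \<kappa> where "\<kappa> = Q x x"
  have stationary: "Q x v = \<kappa> * ip x v" if v: "\<And>j. j \<in> J \<Longrightarrow> ip v (e j) = 0" for v
  proof -
    define b where "b = Q x v - \<kappa> * ip x v"
    define d where "d = Q v v - \<kappa> * ip v v"
    have "0 \<le> 2 * t * b + t\<^sup>2 * d" for t
    proof -
      have "\<kappa> * ip (\<lambda>k. x k + t * v k) (\<lambda>k. x k + t * v k)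
          \<le> Q (\<lambda>k. x k + t * v k) (\<lambda>k. x k + t * v k)"
        unfolding \<kappa>_def by (rule min) (simp add: ip_add x v)
      moreover have "ip (\<lambda>k. x k + t * v k) (\<lambda>k. x k + t * v k) = 1 + 2 * t * ip x v + t\<^sup>2 * ip v v"
        unfolding ip_add ip_commute[of _ "\<lambda>k. x k + t * v k"]
        by (simp add: ip_add x ip_commute[of v x] power2_eq_square algebra_simps)
      moreover have "Q (\<lambda>k. x k + t * v k) (\<lambda>k. x k + t * v k) = \<kappa> + 2 * t * Q x v + t\<^sup>2 * Q v v"
        unfolding Q_add Q_commute[of _ "\<lambda>k. x k + t * v k"]
        by (simp add: Q_add \<kappa>_def Q_commute[of v x] power2_eq_square algebra_simps)
      ultimately show ?thesis by (simp add: b_def d_def algebra_simps)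
    qed
    then have "b = 0" by (rule linear_coeff_zero_if_quadratic_nonneg)
    then show ?thesis by (simp add: b_def)
  qed
  define w where "w k = (\<Sum>m\<in>I. A k m * x m) / r k - \<kappa> * x k" for k
  have ip_w: "ip w g = Q x g - \<kappa> * ip x g" for g
  proof -
    have "r k * w k * g k = (\<Sum>m\<in>I. A k m * x m) * g k - \<kappa> * (r k * x k * g k)" if "k \<in> I" for k
      using weight_pos[OF that] by (simp add: w_def field_simps)
    then show ?thesis
      by (simp add: ip_def[of w] Q_def ip_def[of x] sum_subtractf sum_distrib_left)
  qed
  have "ip w (e j) = 0" if "j \<in> J" for j
  proof -
    have "Q x (e j) = l j * ip (e j) x"
      using eigenpair_Q[OF e[OF that]] by (simp add: Q_commute)
    then show ?thesis using x(2)[OF that] by (simp add: ip_w ip_commute)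
  qed
  then have "ip w w = 0" using stationary by (simp add: ip_w)
  then have "w k = 0" if "k \<in> I" for k using that by (simp add: ip_eq_0_iff)
  then show ?thesis
    unfolding eigenpair_def \<kappa>_def[symmetric] w_def using weight_pos
    by (fastforce simp: field_simps)
qed

text \<open>
  For an orthonormal family, the residual of \<open>f\<close> has squared norm
  \<open>ip f f - (\<Sum>i\<in>J. (ip f (e i))\<^sup>2)\<close>. At the unit vector of \<open>k\<close> this is
  \<open>r k - (\<Sum>i\<in>J. (r k * e i k)\<^sup>2)\<close>. Divided by \<open>r k\<close> and summed over \<open>k\<close>, the first term
  contributes \<open>1\<close> for every point of \<open>I\<close> and the second the squared norm \<open>1\<close> of every \<open>e i\<close>.
  The identity is a count of dimensions: it is the trace of the projection onto the complement.
  The factor \<open>-1\<close> in the residual gives it the shape of \<open>ip_add\<close>.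
\<close>

lemma residual_identity:
  assumes "finite J" and orth: "\<And>i j. i \<in> J \<Longrightarrow> j \<in> J \<Longrightarrow> ip (e i) (e j) = of_bool (i = j)"
  defines "res f \<equiv> \<lambda>k. f k + (-1) * (\<Sum>i\<in>J. ip f (e i) * e i k)"
  shows "j \<in> J \<Longrightarrow> ip (res f) (e j) = 0"
    and "(\<Sum>k\<in>I. ip (res (\<lambda>m. of_bool (m = k))) (res (\<lambda>m. of_bool (m = k))) / r k)
         = real (card I) - real (card J)"
proof -
  show orth_res: "ip (res f) (e j) = 0" if "j \<in> J" for f j
  proof -
    have "(\<Sum>i\<in>J. ip f (e i) * ip (e i) (e j)) = (\<Sum>i\<in>J. if i = j then ip f (e j) else 0)"
      by (intro sum.cong refl) (use that orth in auto)
    then show ?thesis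
      unfolding res_def ip_add ip_sum using that assms(1) by simp
  qed
  have sq: "ip (res f) (res f) = ip f f - (\<Sum>i\<in>J. (ip f (e i))\<^sup>2)" for f
  proof -
    have expand: "ip (res f) w = ip f w + (-1) * (\<Sum>i\<in>J. ip f (e i) * ip (e i) w)" for w
      unfolding res_def ip_add ip_sum by (rule refl)
    have "(\<Sum>i\<in>J. ip f (e i) * ip (e i) (res f)) = 0"
      using orth_res[of _ f] ip_commute[of "res f"] by (intro sum.neutral) auto
    then have "ip (res f) (res f) = ip (res f) f"
      using expand[of "res f"] ip_commute[of f "res f"] by simp
    also have "\<dots> = ip f f + (-1) * (\<Sum>i\<in>J. ip f (e i) * ip (e i) f)"
      by (rule expand)
    also have "(\<Sum>i\<in>J. ip f (e i) * ip (e i) f) = (\<Sum>i\<in>J. (ip f (e i))\<^sup>2)"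
      using ip_commute[of f] by (simp add: power2_eq_square)
    finally show ?thesis by simp
  qed
  have delta: "ip (\<lambda>m. of_bool (m = k)) g = r k * g k" if "k \<in> I" for k g
  proof -
    have "ip (\<lambda>m. of_bool (m = k)) g = (\<Sum>m\<in>I. if m = k then r k * g k else 0)"
      unfolding ip_def by (intro sum.cong) auto
    then show ?thesis using that finite_I by simp
  qed
  have "(\<Sum>k\<in>I. ip (res (\<lambda>m. of_bool (m = k))) (res (\<lambda>m. of_bool (m = k))) / r k)
      = (\<Sum>k\<in>I. 1 - (\<Sum>i\<in>J. r k * e i k * e i k))"
  proof (rule sum.cong)
    fix k assume k: "k \<in> I"
    have "(\<Sum>i\<in>J. (r k * e i k)\<^sup>2) / r k = (\<Sum>i\<in>J. r k * e i k * e i k)"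
      unfolding sum_divide_distrib using weight_pos[OF k]
      by (intro sum.cong refl) (simp add: power2_eq_square)
    then show "ip (res (\<lambda>m. of_bool (m = k))) (res (\<lambda>m. of_bool (m = k))) / r k
        = 1 - (\<Sum>i\<in>J. r k * e i k * e i k)"
      using weight_pos[OF k] by (simp add: sq delta[OF k] diff_divide_distrib)
  qed simp
  also have "\<dots> = real (card I) - (\<Sum>k\<in>I. \<Sum>i\<in>J. r k * e i k * e i k)"
    by (simp add: sum_subtractf)
  also have "(\<Sum>k\<in>I. \<Sum>i\<in>J. r k * e i k * e i k) = (\<Sum>i\<in>J. ip (e i) (e i))"
    unfolding ip_def by (rule sum.swap)
  also have "\<dots> = real (card J)" using orth by simp
  finally show "(\<Sum>k\<in>I. ip (res (\<lambda>m. of_bool (m = k))) (res (\<lambda>m. of_bool (m = k))) / r k)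
         = real (card I) - real (card J)" .
qed

lemma orthogonal_vector_exists:
  assumes "finite J" and "\<And>i j. i \<in> J \<Longrightarrow> j \<in> J \<Longrightarrow> ip (e i) (e j) = of_bool (i = j)"
    and "card J < card I"
  obtains f where "ip f f \<noteq> 0" "\<And>j. j \<in> J \<Longrightarrow> ip f (e j) = 0"
proof -
  define res where "res f = (\<lambda>k. f k + (-1) * (\<Sum>i\<in>J. ip f (e i) * e i k))" for f
  note residual_identity[OF assms(1,2), folded res_def]
  moreover have "real (card I) - real (card J) \<noteq> 0" using assms(3) by simp
  ultimately have "\<exists>k\<in>I. ip (res (\<lambda>m. of_bool (m = k))) (res (\<lambda>m. of_bool (m = k))) / r k \<noteq> 0"
    by (metis (no_types, lifting) sum.neutral)
  then show ?thesis using that residual_identity(1)[OF assms(1,2), folded res_def] by auto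
qed

text \<open>
  All terms of the sum in \<open>residual_identity\<close> are nonnegative, so they vanish if the family has as
  many members as \<open>I\<close> has points. This is the expansion of the unit vectors; by linearity, it
  holds for all functions.
\<close>

lemma orthonormal_expansion:
  assumes "finite J" and "\<And>i j. i \<in> J \<Longrightarrow> j \<in> J \<Longrightarrow> ip (e i) (e j) = of_bool (i = j)"
    and "card J = card I" and "k \<in> I"
  shows "f k = (\<Sum>i\<in>J. ip f (e i) * e i k)"
proof -
  define res where "res f = (\<lambda>k. f k + (-1) * (\<Sum>i\<in>J. ip f (e i) * e i k))" for f
  define \<delta> where "\<delta> k = (\<lambda>m. of_bool (m = k) :: real)" for k :: 'i
  have "(\<Sum>k\<in>I. ip (res (\<delta> k)) (res (\<delta> k)) / r k) = 0"
    using residual_identity(2)[OF assms(1,2), folded res_def] assms(3) by (simp add: \<delta>_def)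
  then have "ip (res (\<delta> k)) (res (\<delta> k)) / r k = 0" if "k \<in> I" for k
    by (subst (asm) sum_nonneg_eq_0_iff)
       (use finite_I weight_pos ip_nonneg that in \<open>auto intro!: divide_nonneg_pos\<close>)
  then have zero: "res (\<delta> k) m = 0" if "k \<in> I" "m \<in> I" for k m
    using that weight_pos[of k] by (force simp: ip_eq_0_iff)
  have "f k = (\<Sum>m\<in>I. f m * \<delta> m k)"
    using assms(4) finite_I by (simp add: \<delta>_def of_bool_def if_distrib cong: if_cong)
  also have "\<dots> = (\<Sum>m\<in>I. f m * (\<Sum>i\<in>J. (r m * e i m) * e i k))"
  proof (intro sum.cong refl)
    fix m assume m: "m \<in> I"
    have "ip (\<delta> m) g = r m * g m" for g
    proof -
      have "ip (\<delta> m) g = (\<Sum>k\<in>I. if k = m then r m * g m else 0)"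
        unfolding ip_def \<delta>_def by (intro sum.cong) auto
      then show ?thesis using m finite_I by simp
    qed
    with zero[OF m assms(4)] show "f m * \<delta> m k = f m * (\<Sum>i\<in>J. (r m * e i m) * e i k)"
      by (simp add: res_def)
  qed
  also have "\<dots> = (\<Sum>i\<in>J. ip f (e i) * e i k)"
    unfolding ip_def sum_distrib_left sum_distrib_right
    by (subst sum.swap) (simp add: algebra_simps)
  finally show ?thesis .
qed

text \<open>
  Together with the eigenvalue equation, the last conjunct says that \<open>l i\<close> is the minimum of the Rayleigh quotient on the complement of the
  preceding eigenvectors. It yields the ordering: for \<open>i \<le> j\<close>, the vector \<open>e j\<close> is a candidate in
  the minimum that defines \<open>l i\<close>.
\<close>

lemma ordered_orthonormal_eigenbasis:
  assumes "n \<le> card I"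
  shows "\<exists>l e. (\<forall>i\<in>{1..n}. \<forall>j\<in>{1..n}. ip (e i) (e j) = of_bool (i = j)) \<and>
    (\<forall>i\<in>{1..n}. eigenpair (l i) (e i)) \<and>
    (\<forall>i\<in>{1..n}. \<forall>g. (\<forall>j\<in>{1..<i}. ip g (e j) = 0) \<longrightarrow> l i * ip g g \<le> Q g g)"
  using assms
proof (induction n)
  case (Suc n)
  then obtain l e where
    orth: "\<And>i j. i \<in> {1..n} \<Longrightarrow> j \<in> {1..n} \<Longrightarrow> ip (e i) (e j) = of_bool (i = j)" and
    eig: "\<And>i. i \<in> {1..n} \<Longrightarrow> eigenpair (l i) (e i)" and
    min: "\<And>i g. i \<in> {1..n} \<Longrightarrow> (\<forall>j\<in>{1..<i}. ip g (e j) = 0) \<Longrightarrow> l i * ip g g \<le> Q g g"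
    using Suc_leD by metis
  obtain f where "ip f f \<noteq> 0" "\<And>j. j \<in> {1..n} \<Longrightarrow> ip f (e j) = 0"
    using orthogonal_vector_exists[of "{1..n}" e] orth Suc.prems by auto
  then obtain x where x: "ip x x = 1" "\<And>j. j \<in> {1..n} \<Longrightarrow> ip x (e j) = 0"
    and xmin: "\<And>g. (\<And>j. j \<in> {1..n} \<Longrightarrow> ip g (e j) = 0) \<Longrightarrow> Q x x * ip g g \<le> Q g g"
    using rayleigh_minimizer[of "{1..n}" f e] by metis
  have xeig: "eigenpair (Q x x) x"
    using minimizer_eigenpair[of "{1..n}" l e x] eig x xmin by blast
  define l' where "l' = l(Suc n := Q x x)"
  define e' where "e' = e(Suc n := x)"
  have old: "l' i = l i" "e' i = e i" if "i \<in> {1..n}" for i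
    using that by (auto simp: l'_def e'_def)
  have new: "l' (Suc n) = Q x x" "e' (Suc n) = x" by (auto simp: l'_def e'_def)
  have split: "{1..Suc n} = insert (Suc n) {1..n}" by auto
  have "\<forall>i\<in>{1..Suc n}. \<forall>j\<in>{1..Suc n}. ip (e' i) (e' j) = of_bool (i = j)"
    unfolding split using orth x by (auto simp: old new ip_commute[of "e i" x for i])
  moreover have "\<forall>i\<in>{1..Suc n}. eigenpair (l' i) (e' i)"
    unfolding split using eig xeig by (auto simp: old new)
  moreover have "l' i * ip g g \<le> Q g g"
    if i: "i \<in> {1..Suc n}" and g: "\<forall>j\<in>{1..<i}. ip g (e' j) = 0" for i g
  proof (cases "i = Suc n")
    case True
    then show ?thesis using xmin[of g] g by (auto simp: new old)
  next
    case False
    then have "i \<in> {1..n}" using i by auto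
    moreover have "\<forall>j\<in>{1..<i}. ip g (e j) = 0"
      using g \<open>i \<in> {1..n}\<close> by (metis atLeastAtMost_iff atLeastLessThan_iff less_imp_le order_trans old(2))
    ultimately show ?thesis using min by (simp add: old)
  qed
  ultimately show ?case by blast
qed simp

text \<open>
  Pairing the equation with the conjugate of \<open>z\<close> gives \<open>S = \<mu> R\<close>, where \<open>S\<close> is real by the symmetry
  of \<open>A\<close> and \<open>R\<close> is the weighted squared norm of \<open>z\<close>.
\<close>

lemma complex_eigenvalue_real:
  fixes z :: "'i \<Rightarrow> complex"
  assumes eq: "\<And>k. k \<in> I \<Longrightarrow> (\<Sum>m\<in>I. A k m *\<^sub>R z m) = \<mu> * (r k *\<^sub>R z k)"
    and nz: "k0 \<in> I" "z k0 \<noteq> 0"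
  shows "\<mu> \<in> \<real>"
proof -
  define S where "S = (\<Sum>k\<in>I. \<Sum>m\<in>I. A k m *\<^sub>R (z m * cnj (z k)))"
  define R where "R = (\<Sum>k\<in>I. r k * (cmod (z k))\<^sup>2)"
  have "S = (\<Sum>k\<in>I. (\<Sum>m\<in>I. A k m *\<^sub>R z m) * cnj (z k))"
    by (simp add: S_def sum_distrib_right)
  also have "\<dots> = (\<Sum>k\<in>I. \<mu> * (r k *\<^sub>R z k) * cnj (z k))" by (simp add: eq)
  also have "\<dots> = \<mu> * of_real R"
  proof -
    have "\<mu> * (r k *\<^sub>R z k) * cnj (z k) = \<mu> * of_real (r k * (cmod (z k))\<^sup>2)" for k
      unfolding of_real_mult complex_norm_square by (simp add: scaleR_conv_of_real)
    then show ?thesis by (simp add: R_def sum_distrib_left)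
  qed
  finally have SR: "S = \<mu> * of_real R" .
  have "cnj S = (\<Sum>k\<in>I. \<Sum>m\<in>I. A k m *\<^sub>R (z k * cnj (z m)))"
    by (simp add: S_def mult.commute)
  also have "\<dots> = (\<Sum>m\<in>I. \<Sum>k\<in>I. A k m *\<^sub>R (z k * cnj (z m)))" by (rule sum.swap)
  also have "\<dots> = S" unfolding S_def by (intro sum.cong refl) (simp add: A_sym)
  finally have "S \<in> \<real>" by (simp add: Reals_cnj_iff)
  moreover have "R > 0"
    unfolding R_def using finite_I nz weight_pos
    by (intro sum_pos2[of I k0]) (auto simp: less_imp_le)
  ultimately show ?thesis
    using Reals_divide[of S "of_real R"] SR by simp
qed

end

section \<open>The Sturm--Liouville operator as a symmetric matrix\<close>

definition gl_matrix :: "real \<Rightarrow> real \<Rightarrow> nat \<Rightarrow> nat \<Rightarrow> real" where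
  "gl_matrix h \<alpha> j m = (if m \<le> j then gl_coeff \<alpha> (j - m) / h powr \<alpha> else 0)"

lemma backward_diff_eq_gl_matrix:
  assumes "k \<le> N"
  shows "backward_diff h \<alpha> u k = (\<Sum>m=0..N. gl_matrix h \<alpha> k m *\<^sub>R u m)"
proof -
  have "(\<Sum>i=0..k. gl_coeff \<alpha> i *\<^sub>R u (k - i)) = (\<Sum>m=0..k. gl_coeff \<alpha> (k - m) *\<^sub>R u m)"
    by (rule sum.reindex_bij_witness[of _ "\<lambda>m. k - m" "\<lambda>i. k - i"]) auto
  then have "backward_diff h \<alpha> u k = (\<Sum>m=0..k. gl_matrix h \<alpha> k m *\<^sub>R u m)"
    by (simp add: backward_diff_def gl_matrix_def scaleR_sum_right divide_inverse mult.commute)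
  also have "\<dots> = (\<Sum>m=0..N. gl_matrix h \<alpha> k m *\<^sub>R u m)"
    by (rule sum.mono_neutral_left) (use assms in \<open>auto simp: gl_matrix_def\<close>)
  finally show ?thesis .
qed

lemma forward_diff_eq_gl_matrix_transpose:
  assumes "k \<le> N"
  shows "forward_diff h N \<alpha> u k = (\<Sum>j=0..N. gl_matrix h \<alpha> j k *\<^sub>R u j)"
proof -
  have "(\<Sum>i=0..N - k. gl_coeff \<alpha> i *\<^sub>R u (k + i)) = (\<Sum>j=k..N. gl_coeff \<alpha> (j - k) *\<^sub>R u j)"
    by (rule sum.reindex_bij_witness[of _ "\<lambda>j. j - k" "\<lambda>i. k + i"]) (use assms in auto)
  then have "forward_diff h N \<alpha> u k = (\<Sum>j=k..N. gl_matrix h \<alpha> j k *\<^sub>R u j)"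
    by (simp add: forward_diff_def gl_matrix_def scaleR_sum_right divide_inverse mult.commute)
  also have "\<dots> = (\<Sum>j=0..N. gl_matrix h \<alpha> j k *\<^sub>R u j)"
    by (rule sum.mono_neutral_left) (auto simp: gl_matrix_def)
  finally show ?thesis .
qed

text \<open>This is \<open>G\<^sup>T P G + diag q\<close> for the matrix \<open>G\<close> of the backward difference.\<close>

definition sl_matrix ::
    "real \<Rightarrow> real \<Rightarrow> nat \<Rightarrow> real \<Rightarrow> (real \<Rightarrow> real) \<Rightarrow> (real \<Rightarrow> real) \<Rightarrow> nat \<Rightarrow> nat \<Rightarrow> real" where
  "sl_matrix a h N \<alpha> p q k m =
     (\<Sum>j=0..N. gl_matrix h \<alpha> j k * p (grid a h j) * gl_matrix h \<alpha> j m)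
     + (if k = m then q (grid a h k) else 0)"

lemma sl_matrix_sym: "sl_matrix a h N \<alpha> p q k m = sl_matrix a h N \<alpha> p q m k"
  by (simp add: sl_matrix_def mult.assoc mult.commute mult.left_commute)

text \<open>
  The differences involve all grid points, but the boundary values of \<open>u\<close> are zero, so that only
  columns of interior points remain. The inner index \<open>j\<close> still ranges over the whole grid.
\<close>

lemma sl_operator_eq_sl_matrix:
  fixes u :: "nat \<Rightarrow> 'a::real_vector"
  assumes k: "k \<in> {1..N-1}" and bc: "u 0 = 0" "u N = 0"
  shows "forward_diff h N \<alpha> (\<lambda>j. p (grid a h j) *\<^sub>R backward_diff h \<alpha> u j) k
      + q (grid a h k) *\<^sub>R u k = (\<Sum>m\<in>{1..N-1}. sl_matrix a h N \<alpha> p q k m *\<^sub>R u m)"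
proof -
  let ?G = "gl_matrix h \<alpha>" and ?p = "\<lambda>j. p (grid a h j)"
  have restrict: "(\<Sum>m=0..N. c m *\<^sub>R u m) = (\<Sum>m\<in>{1..N-1}. c m *\<^sub>R u m)" for c :: "nat \<Rightarrow> real"
  proof (rule sum.mono_neutral_right)
    show "\<forall>m\<in>{0..N} - {1..N-1}. c m *\<^sub>R u m = 0"
    proof
      fix m assume "m \<in> {0..N} - {1..N-1}"
      then have "m = 0 \<or> m = N" by auto
      then show "c m *\<^sub>R u m = 0" using bc by auto
    qed
  qed auto
  have "forward_diff h N \<alpha> (\<lambda>j. ?p j *\<^sub>R backward_diff h \<alpha> u j) k
      = (\<Sum>j=0..N. ?G j k *\<^sub>R (?p j *\<^sub>R (\<Sum>m\<in>{1..N-1}. ?G j m *\<^sub>R u m)))"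
  proof -
    have "backward_diff h \<alpha> u j = (\<Sum>m\<in>{1..N-1}. ?G j m *\<^sub>R u m)" if "j \<in> {0..N}" for j
      using that by (simp only: backward_diff_eq_gl_matrix[of j N] restrict atLeastAtMost_iff)
    moreover have "k \<le> N" using k by auto
    ultimately show ?thesis
      by (simp only: forward_diff_eq_gl_matrix_transpose cong: sum.cong)
  qed
  also have "\<dots> = (\<Sum>m\<in>{1..N-1}. \<Sum>j=0..N. (?G j k * ?p j * ?G j m) *\<^sub>R u m)"
    by (subst sum.swap) (simp add: scaleR_sum_right mult.assoc)
  finally have *: "forward_diff h N \<alpha> (\<lambda>j. ?p j *\<^sub>R backward_diff h \<alpha> u j) k = \<dots>" .
  have "(\<Sum>m\<in>{1..N-1}. (if k = m then q (grid a h k) else 0) *\<^sub>R u m)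
      = (\<Sum>m\<in>{1..N-1}. if k = m then q (grid a h k) *\<^sub>R u k else 0)"
    by (intro sum.cong) auto
  also have "\<dots> = q (grid a h k) *\<^sub>R u k" using k by simp
  finally show ?thesis
    using * by (simp add: sl_matrix_def scaleR_add_left scaleR_sum_left sum.distrib)
qed

lemma inj_grid: "h > 0 \<Longrightarrow> inj (grid a h)"
  by (auto simp: inj_def grid_def)

text \<open>
  Solutions are functions on the real line that vanish off the interior grid points; this is the
  one with prescribed values at these points.
\<close>

definition zero_extension :: "real \<Rightarrow> real \<Rightarrow> nat \<Rightarrow> (nat \<Rightarrow> 'a::zero) \<Rightarrow> real \<Rightarrow> 'a" where
  "zero_extension a h N f x =
     (if x \<in> grid a h ` {1..N-1} then f (inv (grid a h) x) else 0)"

lemma zero_extension_grid: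
  "h > 0 \<Longrightarrow> zero_extension a h N f (grid a h k) = (if k \<in> {1..N-1} then f k else 0)"
  using inj_grid[of h a] by (simp add: zero_extension_def inj_image_mem_iff)

text \<open>
  The codomain is kept general since the real and the complex problem are both needed: the
  latter to exclude eigenvalues that are not real.
\<close>

lemma sl_solutions_iff:
  fixes y :: "real \<Rightarrow> 'a::real_field"
  assumes "h > 0" "N \<ge> 2"
  shows "y \<in> sl_solutions a h N \<alpha> p q r \<mu> \<longleftrightarrow>
    y = zero_extension a h N (\<lambda>k. y (grid a h k)) \<and>
    (\<forall>k\<in>{1..N-1}. (\<Sum>m\<in>{1..N-1}. sl_matrix a h N \<alpha> p q k m *\<^sub>R y (grid a h m))
       = \<mu> * (r (grid a h k) *\<^sub>R y (grid a h k)))"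
proof -
  have "(\<forall>x. x \<notin> grid_dom a h N \<longrightarrow> y x = 0) \<and> y (grid a h 0) = 0 \<and> y (grid a h N) = 0
    \<longleftrightarrow> y = zero_extension a h N (\<lambda>k. y (grid a h k))" (is "?L \<longleftrightarrow> ?R")
  proof
    assume L: ?L
    show ?R
    proof
      fix x
      show "y x = zero_extension a h N (\<lambda>k. y (grid a h k)) x"
      proof (cases "x \<in> grid_dom a h N")
        case True
        then obtain k where k: "k \<le> N" "x = grid a h k" by (auto simp: grid_dom_def)
        have "k = 0 \<or> k = N" if "k \<notin> {1..N-1}" using that k by auto
        then show ?thesis using L k assms by (auto simp: zero_extension_grid)
      next
        case False
        then have "x \<notin> grid a h ` {1..N-1}" by (auto simp: grid_dom_def)
        with L False show ?thesis by (auto simp: zero_extension_def)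
      qed
    qed
  next
    assume R: ?R
    have "y x = 0" if "x \<notin> grid a h ` {1..N-1}" for x
      using fun_cong[OF R, of x] that by (simp only: zero_extension_def if_False)
    moreover have "grid a h 0 \<notin> grid a h ` {1..N-1}" "grid a h N \<notin> grid a h ` {1..N-1}"
      using assms inj_grid[of h a] by (auto simp: inj_image_mem_iff)
    moreover have "grid a h ` {1..N-1} \<subseteq> grid_dom a h N" by (auto simp: grid_dom_def)
    ultimately show ?L by blast
  qed
  moreover have "(\<forall>k\<in>{1..N-1}.
         forward_diff h N \<alpha>
             (\<lambda>j. p (grid a h j) *\<^sub>R backward_diff h \<alpha> (\<lambda>m. y (grid a h m)) j) k
           + q (grid a h k) *\<^sub>R y (grid a h k) = \<mu> * r (grid a h k) *\<^sub>R y (grid a h k))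
     \<longleftrightarrow> (\<forall>k\<in>{1..N-1}. (\<Sum>m\<in>{1..N-1}. sl_matrix a h N \<alpha> p q k m *\<^sub>R y (grid a h m))
       = \<mu> * (r (grid a h k) *\<^sub>R y (grid a h k)))" if "y (grid a h 0) = 0" "y (grid a h N) = 0"
    using sl_operator_eq_sl_matrix[of _ N "\<lambda>m. y (grid a h m)"] that by simp
  ultimately show ?thesis unfolding sl_solutions_def by blast
qed

section \<open>Eigenvalues and eigenfunctions of the boundary value problem\<close>

lemma sum_pointwise: "(\<Sum>i\<in>J. f i) x = (\<Sum>i\<in>J. f i x)"
  for f :: "'i \<Rightarrow> 'b \<Rightarrow> 'c::comm_monoid_add"
  by (induction J rule: infinite_finite_induct) auto

theorem theorem2p4:
  fixes a h \<alpha> :: real and N :: nat and p q r :: "real \<Rightarrow> real"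
  assumes "h > 0" and "N \<ge> 2" and "0 < \<alpha>" and "\<alpha> \<le> 1"
    and "\<And>x. x \<in> grid_dom a h N \<Longrightarrow> p x > 0"
    and "\<And>x. x \<in> grid_dom a h N \<Longrightarrow> r x > 0"
  shows "(\<forall>\<mu>::complex. is_eigenvalue a h N \<alpha> p q r \<mu> \<longrightarrow> \<mu> \<in> \<real>) \<and>
    (\<exists>lam :: nat \<Rightarrow> real.
      (\<forall>i\<in>{1..N-1}. \<forall>j\<in>{1..N-1}. i \<le> j \<longrightarrow> lam i \<le> lam j) \<and>
      (\<forall>\<mu>::real. card {i\<in>{1..N-1}. lam i = \<mu>} = eigen_multiplicity a h N \<alpha> p q r \<mu>) \<and>
      (\<exists>y :: nat \<Rightarrow> real \<Rightarrow> real.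
        (\<forall>i\<in>{1..N-1}. is_eigenfunction a h N \<alpha> p q r (lam i) (y i)) \<and>
        (\<forall>i\<in>{1..N-1}. \<forall>j\<in>{1..N-1}. i \<noteq> j \<longrightarrow> inner_r a h N r (y i) (y j) = 0) \<and>
        (\<forall>\<phi> :: real \<Rightarrow> real.
          (\<exists>!c. c \<in> {1..N-1} \<rightarrow>\<^sub>E UNIV \<and>
             (\<forall>k\<in>{1..N-1}. \<phi> (grid a h k) = (\<Sum>i=1..N-1. c i * y i (grid a h k)))) \<and>
          (\<forall>c :: nat \<Rightarrow> real.
             (\<forall>k\<in>{1..N-1}. \<phi> (grid a h k) = (\<Sum>i=1..N-1. c i * y i (grid a h k))) \<longrightarrow>
             (\<forall>i\<in>{1..N-1}. c i = inner_r a h N r \<phi> (y i) / inner_r a h N r (y i) (y i))))))"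
proof -
  define I where "I = {1..N-1}"
  let ?x = "grid a h"
  have interior: "?x k \<in> grid_dom a h N" if "k \<in> I" for k
    using that by (auto simp: grid_dom_def I_def)
  interpret weighted_symmetric_form I "\<lambda>k. r (?x k)" "sl_matrix a h N \<alpha> p q"
    by unfold_locales (use assms(6) interior sl_matrix_sym in \<open>auto simp: I_def\<close>)
  note sol_iff = sl_solutions_iff[OF assms(1,2), folded I_def]
  note ext_def = zero_extension_def[of a h N, folded I_def]
  note ext_grid = zero_extension_grid[OF assms(1), of a N, folded I_def]
  have inner: "inner_r a h N r f g = ip (\<lambda>k. f (?x k)) (\<lambda>k. g (?x k))" for f g
    unfolding ip_def by (simp add: inner_r_def I_def)
  have real_sol: "f \<in> sl_solutions a h N \<alpha> p q r \<mu> \<longleftrightarrow>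
      f = zero_extension a h N (\<lambda>k. f (?x k)) \<and> eigenpair \<mu> (\<lambda>k. f (?x k))"
    for f :: "real \<Rightarrow> real" and \<mu> by (simp add: sol_iff eigenpair_def)

  have "\<mu> \<in> \<real>" if ev: "is_eigenvalue a h N \<alpha> p q r \<mu>" for \<mu> :: complex
  proof -
    obtain z x0 where z: "z \<in> sl_solutions a h N \<alpha> p q r \<mu>" "z x0 \<noteq> 0"
      using ev by (auto simp: is_eigenvalue_def is_eigenfunction_def)
    then have "zero_extension a h N (\<lambda>k. z (?x k)) x0 \<noteq> 0" by (metis sol_iff)
    then obtain k0 where "k0 \<in> I" "z (?x k0) \<noteq> 0"
      by (metis imageE ext_def ext_grid)
    then show ?thesis
      using complex_eigenvalue_real[of "\<lambda>k. z (?x k)" \<mu> k0] z(1) by (auto simp: sol_iff)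
  qed
  moreover
  obtain lam e where
    e_orth: "\<And>i j. i \<in> I \<Longrightarrow> j \<in> I \<Longrightarrow> ip (e i) (e j) = of_bool (i = j)" and
    e_eig: "\<And>i. i \<in> I \<Longrightarrow> eigenpair (lam i) (e i)" and
    e_min: "\<And>i g. i \<in> I \<Longrightarrow> (\<forall>j\<in>{1..<i}. ip g (e j) = 0) \<Longrightarrow> lam i * ip g g \<le> Q g g"
  proof -
    have "N - 1 \<le> card I" by (simp add: I_def)
    from ordered_orthonormal_eigenbasis[OF this, folded I_def]
    obtain l e where "\<forall>i\<in>I. \<forall>j\<in>I. ip (e i) (e j) = of_bool (i = j)"
      "\<forall>i\<in>I. eigenpair (l i) (e i)"
      "\<forall>i\<in>I. \<forall>g. (\<forall>j\<in>{1..<i}. ip g (e j) = 0) \<longrightarrow> l i * ip g g \<le> Q g g" by blast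
    then show ?thesis by (intro that[of e l]) auto
  qed
  define y where "y i = zero_extension a h N (e i)" for i
  have y_grid: "y i (?x k) = e i k" if "k \<in> I" for i k
    using that by (simp add: y_def ext_grid)
  have y_orth: "inner_r a h N r (y i) (y j) = of_bool (i = j)" if "i \<in> I" "j \<in> I" for i j
  proof -
    have "inner_r a h N r (y i) (y j) = ip (e i) (e j)"
      unfolding inner by (rule ip_cong) (simp_all add: y_grid)
    then show ?thesis using e_orth[OF that] by simp
  qed
  have inner_y: "inner_r a h N r f (y i) = ip (\<lambda>k. f (?x k)) (e i)" for f i
    unfolding inner by (rule ip_cong) (auto simp: y_grid)
  have mono: "lam i \<le> lam j" if "i \<in> I" "j \<in> I" "i \<le> j" for i j
  proof -
    have "\<forall>k\<in>{1..<i}. ip (e j) (e k) = 0"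
    proof
      fix k assume "k \<in> {1..<i}"
      then have "k \<in> I" "k \<noteq> j" using that by (auto simp: I_def)
      then show "ip (e j) (e k) = 0" using e_orth that(2) by simp
    qed
    then have "lam i * ip (e j) (e j) \<le> Q (e j) (e j)" by (rule e_min[OF that(1)])
    also have "\<dots> = lam j * ip (e j) (e j)" by (rule eigenpair_Q[OF e_eig[OF that(2)]])
    finally show ?thesis using e_orth[OF that(2,2)] by simp
  qed
  have expansion: "\<phi> (?x k) = (\<Sum>i\<in>I. inner_r a h N r \<phi> (y i) * y i (?x k))"
    if "k \<in> I" for \<phi> :: "real \<Rightarrow> real" and k
    using orthonormal_expansion[of I e k "\<lambda>k. \<phi> (?x k)"] e_orth finite_I that
    by (simp add: inner_y y_grid)
  have coeff: "c i = inner_r a h N r \<phi> (y i)"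
    if c: "\<forall>k\<in>I. \<phi> (?x k) = (\<Sum>i\<in>I. c i * y i (?x k))" and i: "i \<in> I"
    for \<phi> :: "real \<Rightarrow> real" and c i
  proof -
    have "inner_r a h N r \<phi> (y i) = ip (\<lambda>k. \<Sum>j\<in>I. c j * e j k) (e i)"
      unfolding inner_y by (rule ip_cong) (use c in \<open>auto simp: y_grid\<close>)
    also have "\<dots> = (\<Sum>j\<in>I. if j = i then c i else 0)"
      unfolding ip_sum by (intro sum.cong refl) (use i e_orth in auto)
    also have "\<dots> = c i" using i finite_I by simp
    finally show ?thesis by simp
  qed
  have y_sol: "y i \<in> sl_solutions a h N \<alpha> p q r (lam i)" if "i \<in> I" for i
  proof -
    have "zero_extension a h N (\<lambda>k. y i (?x k)) = y i"
      unfolding y_def[of i] by (rule ext) (auto simp: ext_def ext_grid inj_grid[OF assms(1)])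
    moreover have "eigenpair (lam i) (\<lambda>k. y i (?x k))"
      using e_eig[OF that] by (simp add: eigenpair_def y_grid)
    ultimately show ?thesis by (simp add: real_sol)
  qed
  have y_nonzero: "\<exists>k\<in>I. y i (?x k) \<noteq> 0" if "i \<in> I" for i
    using y_orth[OF that that] ip_eq_0_iff[of "\<lambda>k. y i (?x k)"] by (auto simp: inner)
  have y_eig: "is_eigenfunction a h N \<alpha> p q r (lam i) (y i)" if "i \<in> I" for i
    unfolding is_eigenfunction_def using y_sol[OF that] y_nonzero[OF that] interior by blast

  have mult: "card {i\<in>I. lam i = \<mu>} = eigen_multiplicity a h N \<alpha> p q r \<mu>" for \<mu> :: real
  proof -
    interpret fun_space: vector_space "\<lambda>(c::real) (f::real \<Rightarrow> real) x. c * f x"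
      by unfold_locales (auto simp: fun_eq_iff algebra_simps)
    \<comment> \<open>The eigenfunctions with eigenvalue \<open>\<mu>\<close> form a basis of the solution space for \<open>\<mu>\<close>.\<close>
    define J where "J = {i\<in>I. lam i = \<mu>}"
    have J: "finite J" "J \<subseteq> I" using finite_I by (auto simp: J_def)
    have inj: "inj_on y J"
    proof (rule inj_onI)
      fix i j assume "i \<in> J" "j \<in> J" "y i = y j"
      then show "i = j" using J(2) y_orth[of i i] y_orth[of i j] by (auto simp: subset_iff)
    qed
    have "y ` J \<subseteq> sl_solutions a h N \<alpha> p q r \<mu>" using y_sol by (auto simp: J_def)
    moreover have "sl_solutions a h N \<alpha> p q r \<mu> \<subseteq> fun_space.span (y ` J)"
    proof
      fix f :: "real \<Rightarrow> real" assume "f \<in> sl_solutions a h N \<alpha> p q r \<mu>"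
      then have f: "f = zero_extension a h N (\<lambda>k. f (?x k))" "eigenpair \<mu> (\<lambda>k. f (?x k))"
        by (auto simp: real_sol)
      define c where "c i = inner_r a h N r f (y i)" for i
      have c0: "c i = 0" if "i \<in> I" "i \<notin> J" for i
        using eigenpair_orthogonal[OF f(2) e_eig[OF that(1)]] that by (auto simp: c_def inner_y J_def)
      have "f x = (\<Sum>i\<in>J. c i * y i x)" for x
      proof (cases "x \<in> ?x ` I")
        case True
        then obtain k where k: "k \<in> I" "x = ?x k" by blast
        have "f x = (\<Sum>i\<in>I. c i * y i x)" using expansion[OF k(1)] k(2) by (simp add: c_def)
        also have "\<dots> = (\<Sum>i\<in>J. c i * y i x)"
          by (rule sum.mono_neutral_right) (use finite_I J c0 in auto)
        finally show ?thesis .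
      next
        case False
        have "f x = 0" by (subst f(1)) (simp only: ext_def False if_False)
        moreover have "y i x = 0" for i by (simp only: y_def ext_def False if_False)
        ultimately show ?thesis by simp
      qed
      then have "f = (\<Sum>i\<in>J. (\<lambda>x. c i * y i x))" by (auto simp: fun_eq_iff sum_pointwise)
      then show "f \<in> fun_space.span (y ` J)"
        by (simp only:) (intro fun_space.span_sum fun_space.span_scale fun_space.span_base imageI)
    qed
    moreover have "fun_space.independent (y ` J)"
    proof (rule fun_space.independent_if_scalars_zero)
      fix c v assume "(\<Sum>v\<in>y ` J. (\<lambda>x. c v * v x)) = 0" and v: "v \<in> y ` J"
      then have sum0: "(\<Sum>i\<in>J. (\<lambda>x. c (y i) * y i x)) = 0" using inj by (simp add: sum.reindex)
      have zero: "(\<Sum>i\<in>J. c (y i) * y i x) = 0" for x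
        using fun_cong[OF sum0, of x] by (simp add: sum_pointwise)
      obtain i where i: "i \<in> J" "v = y i" using v by blast
      \<comment> \<open>Padded with zeros, the coefficients expand the zero function, so they are its Fourier
        coefficients.\<close>
      define d where "d i = (if i \<in> J then c (y i) else 0)" for i
      have "(\<Sum>i\<in>I. d i * y i x) = 0" for x
      proof -
        have "(\<Sum>i\<in>I. d i * y i x) = (\<Sum>i\<in>J. d i * y i x)"
          by (rule sum.mono_neutral_right) (use finite_I J in \<open>auto simp: d_def\<close>)
        also have "\<dots> = (\<Sum>i\<in>J. c (y i) * y i x)" by (simp add: d_def)
        finally show ?thesis using zero by simp
      qed
      then have "d i = inner_r a h N r (\<lambda>x. 0) (y i)"
        by (intro coeff) (use i J in auto)
      then show "c v = 0" using i by (simp add: d_def inner_r_def)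
    qed (use J in simp)
    ultimately show ?thesis
      unfolding eigen_multiplicity_def J_def[symmetric]
      using fun_space.dim_unique[of "y ` J"] card_image[OF inj] by simp
  qed

  have basis: "\<exists>!c. c \<in> I \<rightarrow>\<^sub>E UNIV \<and> (\<forall>k\<in>I. \<phi> (?x k) = (\<Sum>i\<in>I. c i * y i (?x k)))"
    for \<phi> :: "real \<Rightarrow> real"
  proof (rule ex1I[of _ "\<lambda>i\<in>I. inner_r a h N r \<phi> (y i)"])
    show "(\<lambda>i\<in>I. inner_r a h N r \<phi> (y i)) \<in> I \<rightarrow>\<^sub>E UNIV \<and>
      (\<forall>k\<in>I. \<phi> (?x k) = (\<Sum>i\<in>I. (\<lambda>i\<in>I. inner_r a h N r \<phi> (y i)) i * y i (?x k)))"
      using expansion[of _ \<phi>] by simp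
    fix c assume c: "c \<in> I \<rightarrow>\<^sub>E UNIV \<and> (\<forall>k\<in>I. \<phi> (?x k) = (\<Sum>i\<in>I. c i * y i (?x k)))"
    show "c = (\<lambda>i\<in>I. inner_r a h N r \<phi> (y i))"
    proof
      fix i
      show "c i = (\<lambda>i\<in>I. inner_r a h N r \<phi> (y i)) i"
        using coeff[OF conjunct2[OF c], of i] PiE_arb[OF conjunct1[OF c], of i]
        by (cases "i \<in> I") simp_all
    qed
  qed
  have "c i = inner_r a h N r \<phi> (y i) / inner_r a h N r (y i) (y i)"
    if "\<forall>k\<in>I. \<phi> (?x k) = (\<Sum>i\<in>I. c i * y i (?x k))" "i \<in> I"
    for \<phi> :: "real \<Rightarrow> real" and c i
    using coeff[OF that] y_orth[OF that(2,2)] by simp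
  with mono mult y_eig y_orth basis
  have "\<exists>lam :: nat \<Rightarrow> real.
      (\<forall>i\<in>I. \<forall>j\<in>I. i \<le> j \<longrightarrow> lam i \<le> lam j) \<and>
      (\<forall>\<mu>::real. card {i\<in>I. lam i = \<mu>} = eigen_multiplicity a h N \<alpha> p q r \<mu>) \<and>
      (\<exists>y :: nat \<Rightarrow> real \<Rightarrow> real.
        (\<forall>i\<in>I. is_eigenfunction a h N \<alpha> p q r (lam i) (y i)) \<and>
        (\<forall>i\<in>I. \<forall>j\<in>I. i \<noteq> j \<longrightarrow> inner_r a h N r (y i) (y j) = 0) \<and>
        (\<forall>\<phi> :: real \<Rightarrow> real.
          (\<exists>!c. c \<in> I \<rightarrow>\<^sub>E UNIV \<and>
             (\<forall>k\<in>I. \<phi> (grid a h k) = (\<Sum>i\<in>I. c i * y i (grid a h k)))) \<and>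
          (\<forall>c :: nat \<Rightarrow> real.
             (\<forall>k\<in>I. \<phi> (grid a h k) = (\<Sum>i\<in>I. c i * y i (grid a h k))) \<longrightarrow>
             (\<forall>i\<in>I. c i = inner_r a h N r \<phi> (y i) / inner_r a h N r (y i) (y i)))))"
    by (intro exI[of _ lam] conjI exI[of _ y] ballI allI impI) simp_all
  ultimately show ?thesis unfolding I_def by blast
qed

end
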